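(* Let $G=(V,E)$ be a graph with finitely many vertices and edges, let $\mathscr{H}$ be the set of all subgraphs of $G$, and let $w:\mathscr{H}\to\mathbb{R}_+$ be a weight function. Define $\widetilde{w}:\mathscr{H}\to\mathbb{R}_+$ by $$\widetilde{w}(H):=\min\Big\{\,w(H_1)+\cdots+w(H_n)\ \Big|\ n\ge 1,\ H_1,\dots,H_n\subseteq H,\ \bigcup_{i=1}^n H_i=H\,\Big\}\qquad (H\in\mathscr{H}).$$ Then $\widetilde{w}$ is the largest subadditive minorant of $w$; that is, $\widetilde{w}$ is subadditive, $\widetilde{w}(H)\le w(H)$ for all $H\in\mathscr{H}$, and every subadditive function $v:\mathscr{H}\to\mathbb{R}_+$ with $v(H)\le w(H)$ for all $H\in\mathscr{H}$ satisfies $v(H)\le\widetilde{w}(H)$ for all $H\in\mathscr{H}$.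
   Context: $\mathbb{R}_+$ denotes the set of non-negative real numbers. For subgraphs, $H\subseteq H'$ means that $H$ is a subgraph of $H'$, and the union of subgraphs is the subgraph whose vertex set and edge set are the unions of the respective vertex sets and edge sets. A weighted graph $G(V,E,w)$ is a graph $G=(V,E)$ together with a function $w:\mathscr{H}\to\mathbb{R}_+$ on the set $\mathscr{H}$ of all subgraphs of $G$. The function $w$ (equivalently, the weighted graph) is called subadditive if $w(H_1\cup H_2)\le w(H_1)+w(H_2)$ for all $H_1,H_2\in\mathscr{H}$. A minorant of $w$ with a property $P$ is a function $v:\mathscr{H}\to\mathbb{R}_+$ having property $P$ with $v(H)\le w(H)$ for all $H\in\mathscr{H}$; the largest such minorant is the one that is pointwise greater than or equal to all others. In the definition of $\widetilde{w}$, $n$ ranges over all positive integers. *)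

theory Defs
  imports Complex_Main
begin

text \<open>
  A graph is a pair of a vertex set and an edge set. The end-vertices of the edges are given by an
  ambient map \<open>ends\<close>, so that loops and parallel edges are allowed; simple graphs are the
  case in which edges are two-element sets of vertices and \<open>ends\<close> is the identity.
\<close>

type_synonym ('v, 'e) graph = "'v set \<times> 'e set"

definition is_graph :: "('e \<Rightarrow> 'v set) \<Rightarrow> ('v, 'e) graph \<Rightarrow> bool" where
  "is_graph ends G \<longleftrightarrow> (\<forall>e \<in> snd G. ends e \<subseteq> fst G \<and> card (ends e) \<in> {1, 2})"

definition subgraph :: "('e \<Rightarrow> 'v set) \<Rightarrow> ('v, 'e) graph \<Rightarrow> ('v, 'e) graph \<Rightarrow> bool" where
  "subgraph ends H G \<longleftrightarrow> is_graph ends H \<and> is_graph ends G \<and> fst H \<subseteq> fst G \<and> snd H \<subseteq> snd G"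

definition subgraphs :: "('e \<Rightarrow> 'v set) \<Rightarrow> ('v, 'e) graph \<Rightarrow> ('v, 'e) graph set" where
  "subgraphs ends G = {H. subgraph ends H G}"

definition graph_union :: "('v, 'e) graph \<Rightarrow> ('v, 'e) graph \<Rightarrow> ('v, 'e) graph" where
  "graph_union H1 H2 = (fst H1 \<union> fst H2, snd H1 \<union> snd H2)"

definition graph_Union :: "('v, 'e) graph set \<Rightarrow> ('v, 'e) graph" where
  "graph_Union \<H> = (\<Union>H\<in>\<H>. fst H, \<Union>H\<in>\<H>. snd H)"

text \<open>
  Functions on the set of subgraphs of a graph are total functions of which only the values on
  \<open>\<H>\<close> matter; in what follows \<open>\<H>\<close> stands for the set of all subgraphs of the
  given graph.
\<close>

definition weight_function :: "('v, 'e) graph set \<Rightarrow> (('v, 'e) graph \<Rightarrow> real) \<Rightarrow> bool" where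
  "weight_function \<H> w \<longleftrightarrow> (\<forall>H\<in>\<H>. 0 \<le> w H)"

definition subadditive :: "('v, 'e) graph set \<Rightarrow> (('v, 'e) graph \<Rightarrow> real) \<Rightarrow> bool" where
  "subadditive \<H> w \<longleftrightarrow> (\<forall>H1\<in>\<H>. \<forall>H2\<in>\<H>. w (graph_union H1 H2) \<le> w H1 + w H2)"

definition minorant ::
  "('v, 'e) graph set \<Rightarrow> ((('v, 'e) graph \<Rightarrow> real) \<Rightarrow> bool) \<Rightarrow>
   (('v, 'e) graph \<Rightarrow> real) \<Rightarrow> (('v, 'e) graph \<Rightarrow> real) \<Rightarrow> bool" where
  "minorant \<H> P w v \<longleftrightarrow> weight_function \<H> v \<and> P v \<and> (\<forall>H\<in>\<H>. v H \<le> w H)"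

definition largest_minorant ::
  "('v, 'e) graph set \<Rightarrow> ((('v, 'e) graph \<Rightarrow> real) \<Rightarrow> bool) \<Rightarrow>
   (('v, 'e) graph \<Rightarrow> real) \<Rightarrow> (('v, 'e) graph \<Rightarrow> real) \<Rightarrow> bool" where
  "largest_minorant \<H> P w u \<longleftrightarrow>
     minorant \<H> P w u \<and> (\<forall>v. minorant \<H> P w v \<longrightarrow> (\<forall>H\<in>\<H>. v H \<le> u H))"

definition cover_sums ::
  "('e \<Rightarrow> 'v set) \<Rightarrow> (('v, 'e) graph \<Rightarrow> real) \<Rightarrow> ('v, 'e) graph \<Rightarrow> real set" where
  "cover_sums ends w H =
     {\<Sum>i=1..n. w (Hs i) | (n :: nat) Hs.
        n \<ge> 1 \<and> (\<forall>i\<in>{1..n}. subgraph ends (Hs i) H) \<and> graph_Union (Hs ` {1..n}) = H}"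

text \<open>
  The set of cover sums is not obviously finite, so its minimum is rendered as its least element;
  \<open>Min\<close> would be meaningful only for finite sets. That the least element exists is not part
  of this definition.
\<close>

definition w_tilde ::
  "('e \<Rightarrow> 'v set) \<Rightarrow> (('v, 'e) graph \<Rightarrow> real) \<Rightarrow> ('v, 'e) graph \<Rightarrow> real" where
  "w_tilde ends w H = (LEAST x. x \<in> cover_sums ends w H)"

end

(* Repeating a subgraph in a cover only increases its cost, so tuples of subgraphs may be replaced
   by sets of subgraphs. A finite graph has only finitely many of those, hence the minimum is
   attained. Joining optimal covers of two subgraphs covers their union, which gives
   subadditivity; and a subadditive minorant at H is bounded by its sum over any cover of H, hence
   by the weight of the cover. *)

theory Submission
  imports Defs
begin

text \<open>Sets replace tuples so that a finite graph has only finitely many covers.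
  \<open>S \<noteq> {}\<close> mirrors \<open>n \<ge> 1\<close>: otherwise the empty graph would
  have a cover of cost 0, below its own weight when that weight is positive.\<close>

definition covers :: "('e \<Rightarrow> 'v set) \<Rightarrow> ('v, 'e) graph \<Rightarrow> ('v, 'e) graph set set" where
  "covers ends H = {S. S \<subseteq> subgraphs ends H \<and> S \<noteq> {} \<and> graph_Union S = H}"

lemma subgraph_trans: "subgraph ends H K \<Longrightarrow> subgraph ends K G \<Longrightarrow> subgraph ends H G"
  unfolding subgraph_def by blast

lemma graph_Union_insert: "graph_Union (insert H S) = graph_union H (graph_Union S)"
  unfolding graph_Union_def graph_union_def by simp

lemma graph_Union_Un: "graph_Union (S \<union> T) = graph_union (graph_Union S) (graph_Union T)"
  unfolding graph_Union_def graph_union_def by auto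

lemma subgraph_graph_union:
  assumes "subgraph ends H G" "subgraph ends K G"
  shows "subgraph ends (graph_union H K) G"
  using assms unfolding subgraph_def is_graph_def graph_union_def by auto

lemma subgraph_graph_union_left:
  assumes "is_graph ends H" "is_graph ends K"
  shows "subgraph ends H (graph_union H K)"
  using assms unfolding subgraph_def is_graph_def graph_union_def by auto

lemma subgraph_graph_union_right:
  assumes "is_graph ends H" "is_graph ends K"
  shows "subgraph ends K (graph_union H K)"
  using assms unfolding subgraph_def is_graph_def graph_union_def by auto

lemma finite_subgraphs:
  assumes "finite (fst G)" "finite (snd G)"
  shows "finite (subgraphs ends G)"
proof (rule finite_subset)
  show "subgraphs ends G \<subseteq> Pow (fst G) \<times> Pow (snd G)"
    unfolding subgraphs_def subgraph_def by auto
qed (use assms in simp)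

lemma subgraphs_mono: "H \<in> subgraphs ends G \<Longrightarrow> subgraphs ends H \<subseteq> subgraphs ends G"
  unfolding subgraphs_def using subgraph_trans by blast

lemma singleton_in_covers: "is_graph ends H \<Longrightarrow> {H} \<in> covers ends H"
  unfolding covers_def subgraphs_def subgraph_def graph_Union_def by simp

lemma Un_in_covers:
  assumes S: "S \<in> covers ends H" and T: "T \<in> covers ends K"
    and "is_graph ends H" "is_graph ends K"
  shows "S \<union> T \<in> covers ends (graph_union H K)"
proof -
  have "subgraphs ends H \<subseteq> subgraphs ends (graph_union H K)"
    "subgraphs ends K \<subseteq> subgraphs ends (graph_union H K)"
    using subgraph_graph_union_left[OF assms(3,4)] subgraph_graph_union_right[OF assms(3,4)]
    by (auto simp: subgraphs_def intro: subgraph_trans)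
  then show ?thesis
    using S T unfolding covers_def by (auto simp: graph_Union_Un)
qed

text \<open>Enumerating \<open>S\<close> without repetition gives a tuple with exactly the same
  cost.\<close>

lemma sum_cover_in_cover_sums:
  assumes "S \<in> covers ends H" "finite S"
  shows "sum w S \<in> cover_sums ends w H"
proof -
  obtain Hs where Hs: "bij_betw Hs {1..card S} S"
    using ex_bij_betw_nat_finite_1[OF \<open>finite S\<close>] by blast
  have "card S \<ge> 1"
    using assms unfolding covers_def by (simp add: Suc_le_eq card_gt_0_iff)
  moreover have "sum w S = (\<Sum>i=1..card S. w (Hs i))"
    using sum.reindex_bij_betw[OF Hs, of w] by simp
  moreover have "Hs ` {1..card S} = S"
    using Hs by (rule bij_betw_imp_surj_on)
  moreover have "\<forall>i\<in>{1..card S}. subgraph ends (Hs i) H"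
    using bij_betw_apply[OF Hs] assms unfolding covers_def subgraphs_def by blast
  moreover have "graph_Union S = H"
    using assms unfolding covers_def by blast
  ultimately show ?thesis
    unfolding cover_sums_def mem_Collect_eq by (intro exI[of _ "card S"] exI[of _ Hs]) simp
qed

text \<open>The image of a tuple forgets multiplicities. Since weights are nonnegative, dropping
  repeated terms cannot increase the sum.\<close>

lemma cover_sums_ge_sum_cover:
  assumes "x \<in> cover_sums ends w H" "weight_function (subgraphs ends H) w"
  obtains S where "S \<in> covers ends H" "sum w S \<le> x"
proof -
  obtain n :: nat and Hs where n: "n \<ge> 1" and Hs: "\<forall>i\<in>{1..n}. subgraph ends (Hs i) H"
    and U: "graph_Union (Hs ` {1..n}) = H" and x: "x = (\<Sum>i=1..n. w (Hs i))"
    using assms unfolding cover_sums_def by blast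
  have "sum w (Hs ` {1..n}) \<le> sum (w \<circ> Hs) {1..n}"
    using Hs assms(2) by (intro sum_image_le) (simp_all add: weight_function_def subgraphs_def del: split_paired_All)
  moreover have "Hs ` {1..n} \<in> covers ends H"
    using n Hs U unfolding covers_def subgraphs_def by auto
  ultimately show ?thesis
    using that x by simp
qed

text \<open>This is what gives the \<open>LEAST\<close> in \<open>w_tilde\<close> its meaning. A
  minimum exists over the finite set \<open>covers ends H\<close>, and the two preceding lemmas
  carry it over to \<open>cover_sums\<close>, which may be infinite.\<close>

lemma least_cover_sum:
  assumes "is_graph ends H" "finite (subgraphs ends H)" "weight_function (subgraphs ends H) w"
  obtains S where "S \<in> covers ends H" "w_tilde ends w H = sum w S"
    "\<And>x. x \<in> cover_sums ends w H \<Longrightarrow> w_tilde ends w H \<le> x"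
proof -
  have "covers ends H \<subseteq> Pow (subgraphs ends H)"
    unfolding covers_def by blast
  then have "finite (covers ends H)"
    using assms(2) by (simp add: finite_subset)
  moreover have "covers ends H \<noteq> {}"
    using singleton_in_covers[OF assms(1)] by blast
  ultimately have "is_arg_min (sum w) (\<lambda>S. S \<in> covers ends H) (arg_min_on (sum w) (covers ends H))"
    by (simp add: is_arg_min_linorder arg_min_if_finite(1) arg_min_least)
  then obtain S where S: "S \<in> covers ends H"
    and min: "\<And>T. T \<in> covers ends H \<Longrightarrow> sum w S \<le> sum w T"
    unfolding is_arg_min_linorder by blast
  have "finite S"
    using S assms(2) unfolding covers_def by (auto intro: finite_subset)
  then have mem: "sum w S \<in> cover_sums ends w H"
    using S by (intro sum_cover_in_cover_sums)
  have least: "sum w S \<le> x" if x: "x \<in> cover_sums ends w H" for x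
  proof -
    obtain T where "T \<in> covers ends H" "sum w T \<le> x"
      using x assms(3) by (rule cover_sums_ge_sum_cover)
    then show ?thesis
      using min[of T] by linarith
  qed
  have "w_tilde ends w H = sum w S"
    unfolding w_tilde_def using mem least by (rule Least_equality)
  then show ?thesis
    using that S least by simp
qed

text \<open>Membership of the union is proved in the same induction because subadditivity applies
  only to members of \<open>subgraphs ends G\<close>. The induction starts at singletons: for empty
  \<open>S\<close> the bound would read v(empty graph) \<le> 0, which may fail.\<close>

lemma subadditive_graph_Union_le:
  assumes v: "subadditive (subgraphs ends G) v"
    and "finite S" "S \<noteq> {}" "S \<subseteq> subgraphs ends G"
  shows "graph_Union S \<in> subgraphs ends G \<and> v (graph_Union S) \<le> sum v S"
  using assms(2-4)
proof (induction S rule: finite_ne_induct)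
  case (singleton H)
  then show ?case by (simp add: graph_Union_def)
next
  case (insert H S)
  then have "v (graph_union H (graph_Union S)) \<le> v H + v (graph_Union S)"
    using v unfolding subadditive_def by simp
  then show ?case
    using insert subgraph_graph_union[of ends H G "graph_Union S"]
    by (simp add: graph_Union_insert subgraphs_def)
qed

theorem proposition1p4:
  fixes ends :: "'e \<Rightarrow> 'v set"
    and G :: "('v, 'e) graph"
    and w :: "('v, 'e) graph \<Rightarrow> real"
  assumes "is_graph ends G"
    and "finite (fst G)"
    and "finite (snd G)"
    and "weight_function (subgraphs ends G) w"
  shows "(\<forall>H\<in>subgraphs ends G.
            w_tilde ends w H \<in> cover_sums ends w H \<and>
            (\<forall>x\<in>cover_sums ends w H. w_tilde ends w H \<le> x)) \<and>
         largest_minorant (subgraphs ends G) (subadditive (subgraphs ends G)) w (w_tilde ends w)"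
proof -
  have sub: "is_graph ends H" "finite (subgraphs ends H)" "weight_function (subgraphs ends H) w"
    if "H \<in> subgraphs ends G" for H
  proof -
    show "is_graph ends H"
      using that unfolding subgraphs_def subgraph_def by blast
    show "finite (subgraphs ends H)"
      using finite_subgraphs[OF assms(2,3)] subgraphs_mono[OF that] by (rule finite_subset[rotated])
    show "weight_function (subgraphs ends H) w"
      using assms(4) subgraphs_mono[OF that] unfolding weight_function_def by blast
  qed
  \<comment> \<open>Covers of \<open>H\<close> are placed inside \<open>subgraphs ends G\<close>,
    where the assumptions on \<open>w\<close> and on minorants are stated.\<close>
  have attained: "\<exists>S\<in>covers ends H. finite S \<and> S \<subseteq> subgraphs ends G \<and> w_tilde ends w H = sum w S"
    if H: "H \<in> subgraphs ends G" for H
  proof -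
    obtain S where "S \<in> covers ends H" "w_tilde ends w H = sum w S"
      by (rule least_cover_sum[OF sub[OF H]])
    then show ?thesis
      using sub(2)[OF H] subgraphs_mono[OF H] unfolding covers_def
      by (blast intro: finite_subset)
  qed
  have least: "w_tilde ends w H \<le> x" if "H \<in> subgraphs ends G" "x \<in> cover_sums ends w H" for H x
    by (rule least_cover_sum[OF sub[OF that(1)]]) (use that(2) in blast)
  have mem: "w_tilde ends w H \<in> cover_sums ends w H" if "H \<in> subgraphs ends G" for H
    using attained[OF that] sum_cover_in_cover_sums by metis
  have nonneg: "weight_function (subgraphs ends G) (w_tilde ends w)"
    unfolding weight_function_def
  proof
    fix H assume "H \<in> subgraphs ends G"
    then obtain S where "S \<subseteq> subgraphs ends G" "w_tilde ends w H = sum w S"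
      using attained by blast
    then show "0 \<le> w_tilde ends w H"
      using assms(4) unfolding weight_function_def by (auto intro!: sum_nonneg)
  qed
  have subadd: "subadditive (subgraphs ends G) (w_tilde ends w)"
    unfolding subadditive_def
  proof (intro ballI)
    fix H K assume H: "H \<in> subgraphs ends G" and K: "K \<in> subgraphs ends G"
    obtain S where S: "S \<in> covers ends H" "finite S" "S \<subseteq> subgraphs ends G"
      "w_tilde ends w H = sum w S"
      using attained[OF H] by blast
    obtain T where T: "T \<in> covers ends K" "finite T" "T \<subseteq> subgraphs ends G"
      "w_tilde ends w K = sum w T"
      using attained[OF K] by blast
    have "graph_union H K \<in> subgraphs ends G"
      using H K unfolding subgraphs_def by (simp add: subgraph_graph_union)
    \<comment> \<open>The union of the two optimal covers need not be optimal, but it competes in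
      the minimum for \<open>graph_union H K\<close>.\<close>
    then have "w_tilde ends w (graph_union H K) \<le> sum w (S \<union> T)"
      using S T by (intro least sum_cover_in_cover_sums Un_in_covers sub(1) H K) simp_all
    also have "\<dots> \<le> sum w S + sum w T"
    proof -
      \<comment> \<open>Common members count once in \<open>S \<union> T\<close> but twice on the
        right, so the gap is exactly this sum.\<close>
      have "0 \<le> sum w (S \<inter> T)"
        using S(3) assms(4) unfolding weight_function_def by (auto intro!: sum_nonneg)
      then show ?thesis
        using sum.union_inter[OF S(2) T(2), of w] by simp
    qed
    finally show "w_tilde ends w (graph_union H K) \<le> w_tilde ends w H + w_tilde ends w K"
      using S T by simp
  qed
  have below: "w_tilde ends w H \<le> w H" if "H \<in> subgraphs ends G" for H
    \<comment> \<open>The competitor is the one-element cover \<open>{H}\<close>, whose cost is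
      \<open>w H\<close>.\<close>
    using least[OF that sum_cover_in_cover_sums[OF singleton_in_covers[OF sub(1)[OF that]]]] by simp
  have largest: "v H \<le> w_tilde ends w H"
    if v: "minorant (subgraphs ends G) (subadditive (subgraphs ends G)) w v"
      and H: "H \<in> subgraphs ends G" for v H
  proof -
    obtain S where S: "S \<in> covers ends H" "finite S" "S \<subseteq> subgraphs ends G"
      "w_tilde ends w H = sum w S"
      using attained[OF H] by blast
    \<comment> \<open>Here \<open>H\<close> is the union of the optimal cover \<open>S\<close>, so
      subadditivity of \<open>v\<close> splits it into the members of \<open>S\<close>, on each of
      which \<open>v\<close> lies below \<open>w\<close>.\<close>
    have "v H \<le> sum v S"
      using subadditive_graph_Union_le[of ends G v S] S v unfolding covers_def minorant_def by auto
    also have "\<dots> \<le> sum w S"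
      using S(3) v unfolding minorant_def by (intro sum_mono) blast
    finally show ?thesis
      using S by simp
  qed
  show ?thesis
    using mem least nonneg subadd below largest
    unfolding largest_minorant_def minorant_def by blast
qed

end
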